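(* Let $\Delta_1,\dots,\Delta_m\subset\{1,\dots,n\}$, let $g_i\in\mathbb{R}[x_{\Delta_i}]$ for $i=1,\dots,m$, let $f_i=g_i^2$ and $f(x)=\sum_{i=1}^m f_i(x_{\Delta_i})=\sum_{i=1}^m g_i^2(x_{\Delta_i})$, with $\deg f=2d$. If the polynomial system $$g_1(x_{\Delta_1})=g_2(x_{\Delta_2})=\cdots=g_m(x_{\Delta_m})=0$$ admits a real solution $x\in\mathbb{R}^n$, then the sparse SOS relaxation is exact, i.e. $f^*_\Delta=f^*_{sos}=f^*$.
   Context: For $\Delta_i\subset\{1,\dots,n\}$, $x_{\Delta_i}=(x_j)_{j\in\Delta_i}$, and $\mathbf{m}_d(x_{\Delta_i})$ is the column vector of all monomials in $x_{\Delta_i}$ of degree at most $d$. Values: $f^*=\inf_{x\in\mathbb{R}^n}f(x)$; $f^*_{sos}=\sup\{\gamma\in\mathbb{R}:f(x)-\gamma\text{ is a sum of squares of real polynomials}\}$; $f^*_\Delta=\sup\{\gamma\in\mathbb{R}: f(x)-\gamma=\sum_{i=1}^m\mathbf{m}_d(x_{\Delta_i})^TW_i\,\mathbf{m}_d(x_{\Delta_i})\text{ identically in }x\text{ for some real symmetric positive semidefinite }W_1,\dots,W_m\}$ (the sparse SOS relaxation). *)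

theory Defs
  imports "HOL-Analysis.Analysis" "HOL-Library.Poly_Mapping"
begin

text \<open>
  Real polynomials in the variables \<open>x $ j\<close>, for \<open>j\<close> ranging over a finite type of size \<open>n\<close>:
  finitely supported coefficient functions on exponent vectors. The ring structure is the
  convolution product of \<open>Poly_Mapping\<close>.
\<close>

type_synonym 'n monomial = "'n \<Rightarrow>\<^sub>0 nat"
type_synonym 'n real_mpoly = "'n monomial \<Rightarrow>\<^sub>0 real"

definition monom_degree :: "'n monomial \<Rightarrow> nat" where
  "monom_degree \<alpha> = (\<Sum>j\<in>Poly_Mapping.keys \<alpha>. Poly_Mapping.lookup \<alpha> j)"

text \<open>The zero polynomial has degree 0.\<close>

definition total_degree :: "'n real_mpoly \<Rightarrow> nat" where
  "total_degree p = Max (insert 0 (monom_degree ` Poly_Mapping.keys p))"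

definition const_mpoly :: "real \<Rightarrow> 'n real_mpoly" where
  "const_mpoly c = Poly_Mapping.single 0 c"

definition mpolys_in :: "'n set \<Rightarrow> 'n real_mpoly set" where
  "mpolys_in \<Delta> = {p. \<forall>\<alpha>\<in>Poly_Mapping.keys p. Poly_Mapping.keys \<alpha> \<subseteq> \<Delta>}"

definition monom_eval :: "'n::finite monomial \<Rightarrow> real ^ 'n \<Rightarrow> real" where
  "monom_eval \<alpha> x = (\<Prod>j\<in>UNIV. (x $ j) ^ Poly_Mapping.lookup \<alpha> j)"

definition mpoly_eval :: "'n::finite real_mpoly \<Rightarrow> real ^ 'n \<Rightarrow> real" where
  "mpoly_eval p x = (\<Sum>\<alpha>\<in>Poly_Mapping.keys p. Poly_Mapping.lookup p \<alpha> * monom_eval \<alpha> x)"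

text \<open>
  The three optimal values are extended reals, so that an unbounded infimum or the supremum of
  an empty set of feasible \<open>\<gamma>\<close> is \<open>-\<infinity>\<close>.
\<close>

definition inf_value :: "'n::finite real_mpoly \<Rightarrow> ereal" where
  "inf_value f = (INF x. ereal (mpoly_eval f x))"

definition is_sos :: "'n real_mpoly \<Rightarrow> bool" where
  "is_sos p \<longleftrightarrow> (\<exists>qs. p = (\<Sum>q\<leftarrow>qs. q ^ 2))"

definition sos_value :: "'n::finite real_mpoly \<Rightarrow> ereal" where
  "sos_value f = (SUP \<gamma>\<in>{\<gamma>. is_sos (f - const_mpoly \<gamma>)}. ereal \<gamma>)"

text \<open>
  \<open>monomials d \<Delta>\<close> is the index set of the vector of all monomials of degree at most \<open>d\<close> in the
  variables from \<open>\<Delta>\<close>; a matrix with rows and columns indexed by these monomials is a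
  function of two exponent vectors, of which only the values on the index set matter.
\<close>

definition monomials :: "nat \<Rightarrow> 'n set \<Rightarrow> 'n monomial set" where
  "monomials d \<Delta> = {\<alpha>. Poly_Mapping.keys \<alpha> \<subseteq> \<Delta> \<and> monom_degree \<alpha> \<le> d}"

definition quad_form :: "'a set \<Rightarrow> ('a \<Rightarrow> 'a \<Rightarrow> real) \<Rightarrow> ('a \<Rightarrow> real) \<Rightarrow> real" where
  "quad_form A W v = (\<Sum>\<alpha>\<in>A. \<Sum>\<beta>\<in>A. v \<alpha> * W \<alpha> \<beta> * v \<beta>)"

definition sym_psd_on :: "'a set \<Rightarrow> ('a \<Rightarrow> 'a \<Rightarrow> real) \<Rightarrow> bool" where
  "sym_psd_on A W \<longleftrightarrow>
     (\<forall>\<alpha>\<in>A. \<forall>\<beta>\<in>A. W \<alpha> \<beta> = W \<beta> \<alpha>) \<and> (\<forall>v. 0 \<le> quad_form A W v)"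

definition sparse_sos_feasible ::
  "nat \<Rightarrow> nat \<Rightarrow> (nat \<Rightarrow> 'n::finite set) \<Rightarrow> 'n real_mpoly \<Rightarrow> real \<Rightarrow> bool" where
  "sparse_sos_feasible d m \<Delta> f \<gamma> \<longleftrightarrow>
     (\<exists>W. (\<forall>i\<in>{1..m}. sym_psd_on (monomials d (\<Delta> i)) (W i)) \<and>
          (\<forall>x. mpoly_eval f x - \<gamma> =
                 (\<Sum>i=1..m. quad_form (monomials d (\<Delta> i)) (W i) (\<lambda>\<alpha>. monom_eval \<alpha> x))))"

definition sparse_sos_value ::
  "nat \<Rightarrow> nat \<Rightarrow> (nat \<Rightarrow> 'n::finite set) \<Rightarrow> 'n real_mpoly \<Rightarrow> ereal" where
  "sparse_sos_value d m \<Delta> f = (SUP \<gamma>\<in>{\<gamma>. sparse_sos_feasible d m \<Delta> f \<gamma>}. ereal \<gamma>)"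

text \<open>Finiteness of the index set; without it the sums in \<open>quad_form\<close> would be 0.\<close>

lemma finite_monomials: "finite (monomials d (\<Delta> :: 'n::finite set))"
proof -
  have "Poly_Mapping.lookup \<alpha> j \<le> d" if "\<alpha> \<in> monomials d \<Delta>" for \<alpha> j
  proof (cases "j \<in> Poly_Mapping.keys \<alpha>")
    case True
    then have "Poly_Mapping.lookup \<alpha> j \<le> monom_degree \<alpha>"
      unfolding monom_degree_def by (intro member_le_sum) auto
    with that show ?thesis
      by (simp add: monomials_def)
  next
    case False
    then show ?thesis
      by (simp add: in_keys_iff)
  qed
  then have "Poly_Mapping.lookup ` monomials d \<Delta> \<subseteq> Pi\<^sub>E UNIV (\<lambda>_. {..d})"
    by auto
  moreover have "finite (Pi\<^sub>E (UNIV :: 'n set) (\<lambda>_. {..d}))"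
    by (intro finite_PiE) auto
  ultimately have "finite (Poly_Mapping.lookup ` monomials d \<Delta>)"
    by (rule finite_subset)
  then show ?thesis
    by (rule finite_imageD) (simp add: inj_on_def lookup_inject)
qed

end

theory Submission
  imports Defs
begin

text \<open>
  All three values are 0: the common zero gives \<open>f\<^sup>* = 0\<close>, every certificate for \<open>\<gamma>\<close> bounds
  \<open>f - \<gamma>\<close> from below by 0, and \<open>\<gamma> = 0\<close> is certified by \<open>f = \<Sum> g\<^sub>i\<^sup>2\<close> itself, with
  \<open>W\<^sub>i\<close> the rank-one matrix of the coefficients of \<open>g\<^sub>i\<close>. The last point requires
  \<open>deg g\<^sub>i \<le> d\<close>, that is, that leading terms cannot cancel in a sum of squares. To see this,
  choose among the monomials of maximal degree occurring in the \<open>g\<^sub>i\<close> an exponent vector \<open>\<alpha>\<close> of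
  maximal Euclidean norm. It is not the midpoint of two other occurring exponents, so the
  coefficient of \<open>f\<close> at \<open>2\<alpha>\<close> is the sum of the squares of the coefficients of the \<open>g\<^sub>i\<close> at
  \<open>\<alpha>\<close>, hence positive.
\<close>

section \<open>Evaluation as a ring homomorphism\<close>

lemma mpoly_eval_zero [simp]: "mpoly_eval 0 x = 0"
  by (simp add: mpoly_eval_def)

lemma mpoly_eval_add: "mpoly_eval (p + q) x = mpoly_eval p x + mpoly_eval q x"
  unfolding mpoly_eval_def
  \<comment> \<open>Cancellation may remove keys from \<open>p + q\<close>; this is harmless, since
    the summand is additive in the coefficient and vanishes at coefficient 0.\<close>
  by (rule setsum_keys_plus_distrib) (simp_all add: distrib_right)

lemma mpoly_eval_sum: "mpoly_eval (\<Sum>i\<in>A. p i) x = (\<Sum>i\<in>A. mpoly_eval (p i) x)"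
  by (induction A rule: infinite_finite_induct) (simp_all add: mpoly_eval_add)

lemma mpoly_eval_sum_list: "mpoly_eval (\<Sum>q\<leftarrow>qs. p q) x = (\<Sum>q\<leftarrow>qs. mpoly_eval (p q) x)"
  by (induction qs) (simp_all add: mpoly_eval_add)

lemma mpoly_eval_diff: "mpoly_eval (p - q) x = mpoly_eval p x - mpoly_eval q x"
  using mpoly_eval_add [of "p - q" q x] by simp

lemma mpoly_eval_single: "mpoly_eval (Poly_Mapping.single \<alpha> c) x = c * monom_eval \<alpha> x"
  by (simp add: mpoly_eval_def)

lemma mpoly_eval_const [simp]: "mpoly_eval (const_mpoly c) x = c"
  by (simp add: const_mpoly_def mpoly_eval_single monom_eval_def)

lemma monom_eval_add: "monom_eval (\<alpha> + \<beta>) x = monom_eval \<alpha> x * monom_eval \<beta> x"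
  by (simp add: monom_eval_def lookup_add power_add prod.distrib)

lemma sum_single_keys:
  "(\<Sum>\<alpha>\<in>Poly_Mapping.keys p. Poly_Mapping.single \<alpha> (Poly_Mapping.lookup p \<alpha>)) = p"
  by (rule poly_mapping_eqI) (simp add: lookup_sum lookup_single when_def sum.delta in_keys_iff)

lemma mpoly_eval_mult: "mpoly_eval (p * q) x = mpoly_eval p x * mpoly_eval q x"
proof -
  \<comment> \<open>Splitting both factors into single terms reduces the convolution product to
    \<open>monom_eval_add\<close>.\<close>
  have "mpoly_eval (p * q) x =
      mpoly_eval ((\<Sum>\<alpha>\<in>Poly_Mapping.keys p. Poly_Mapping.single \<alpha> (Poly_Mapping.lookup p \<alpha>)) *
        (\<Sum>\<beta>\<in>Poly_Mapping.keys q. Poly_Mapping.single \<beta> (Poly_Mapping.lookup q \<beta>))) x"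
    by (simp only: sum_single_keys)
  also have "\<dots> = (\<Sum>\<alpha>\<in>Poly_Mapping.keys p. \<Sum>\<beta>\<in>Poly_Mapping.keys q.
      (Poly_Mapping.lookup p \<alpha> * monom_eval \<alpha> x) * (Poly_Mapping.lookup q \<beta> * monom_eval \<beta> x))"
    by (simp add: sum_product mpoly_eval_sum mult_single mpoly_eval_single monom_eval_add mult_ac)
  also have "\<dots> = mpoly_eval p x * mpoly_eval q x"
    by (simp add: mpoly_eval_def sum_product)
  finally show ?thesis .
qed

lemma mpoly_eval_power2: "mpoly_eval (p\<^sup>2) x = (mpoly_eval p x)\<^sup>2"
  by (simp add: power2_eq_square mpoly_eval_mult)

lemma is_sos_eval_nonneg:
  assumes "is_sos p"
  shows "0 \<le> mpoly_eval p x"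
  using assms unfolding is_sos_def
  by (auto simp: mpoly_eval_sum_list mpoly_eval_power2 intro!: sum_list_nonneg)

section \<open>Degrees and extreme monomials\<close>

lemma monom_degree_eq_sum: "monom_degree \<alpha> = (\<Sum>j\<in>UNIV. Poly_Mapping.lookup \<alpha> j)"
  for \<alpha> :: "'n::finite monomial"
  unfolding monom_degree_def by (rule sum.mono_neutral_left) (auto simp: in_keys_iff)

lemma monom_degree_add: "monom_degree (\<alpha> + \<beta>) = monom_degree \<alpha> + monom_degree \<beta>"
  for \<alpha> \<beta> :: "'n::finite monomial"
  by (simp add: monom_degree_eq_sum lookup_add sum.distrib)

lemma monom_degree_le_total_degree:
  "\<alpha> \<in> Poly_Mapping.keys p \<Longrightarrow> monom_degree \<alpha> \<le> total_degree p"
  unfolding total_degree_def by (rule Max_ge) auto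

text \<open>In the convolution sum over \<beta> + \<gamma> = 2\<alpha> only the pair (\<alpha>,
  \<alpha>) can survive. If \<alpha> does not occur in \<open>p\<close>, both sides are 0, so one
  common \<alpha> can serve for all the \<open>g i\<close>.\<close>

lemma lookup_power2_extreme:
  fixes p :: "'n real_mpoly"
  assumes extreme: "\<And>\<beta> \<gamma>. \<beta> \<in> Poly_Mapping.keys p \<Longrightarrow> \<gamma> \<in> Poly_Mapping.keys p \<Longrightarrow>
    \<beta> + \<gamma> = \<alpha> + \<alpha> \<Longrightarrow> \<beta> = \<alpha>"
  shows "Poly_Mapping.lookup (p\<^sup>2) (\<alpha> + \<alpha>) = (Poly_Mapping.lookup p \<alpha>)\<^sup>2"
proof -
  let ?c = "Poly_Mapping.lookup p"
  have "?c \<beta> * (\<Sum>\<gamma>. ?c \<gamma> when \<alpha> + \<alpha> = \<beta> + \<gamma>) = (?c \<alpha> * ?c \<alpha> when \<beta> = \<alpha>)" for \<beta>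
  proof (cases "\<beta> = \<alpha>")
    case False
    have "?c \<beta> * (\<Sum>\<gamma>. ?c \<gamma> when \<alpha> + \<alpha> = \<beta> + \<gamma>) = 0"
    proof (cases "?c \<beta> = 0")
      case nz: False
      have "(?c \<gamma> when \<alpha> + \<alpha> = \<beta> + \<gamma>) = 0" for \<gamma>
        using extreme [of \<beta> \<gamma>] False nz by (cases "?c \<gamma> = 0") (auto simp: in_keys_iff when_def)
      then show ?thesis
        by simp
    qed simp
    with False show ?thesis
      by simp
  qed simp
  then show ?thesis
    by (simp add: power2_eq_square lookup_mult)
qed

lemma extreme_monomial_exists:
  fixes K :: "'n::finite monomial set"
  assumes "finite K" "K \<noteq> {}"
  obtains \<alpha> where "\<alpha> \<in> K" "\<And>\<beta>. \<beta> \<in> K \<Longrightarrow> monom_degree \<beta> \<le> monom_degree \<alpha>"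
    "\<And>\<beta> \<gamma>. \<beta> \<in> K \<Longrightarrow> \<gamma> \<in> K \<Longrightarrow> \<beta> + \<gamma> = \<alpha> + \<alpha> \<Longrightarrow> \<beta> = \<alpha>"
proof -
  \<comment> \<open>The squared Euclidean norm, taken in \<open>int\<close> because subtraction on
    \<open>nat\<close> truncates.\<close>
  define N :: "'n monomial \<Rightarrow> int" where
    "N \<beta> = (\<Sum>j\<in>UNIV. (int (Poly_Mapping.lookup \<beta> j))\<^sup>2)" for \<beta>
  define D where "D = Max (monom_degree ` K)"
  define L where "L = {\<beta> \<in> K. monom_degree \<beta> = D}"
  have D_ge: "monom_degree \<beta> \<le> D" if "\<beta> \<in> K" for \<beta>
    using that assms by (simp add: D_def)
  have "D \<in> monom_degree ` K"
    using assms by (simp add: D_def)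
  then have "finite L" "L \<noteq> {}"
    using assms by (auto simp: L_def)
  then have "Max (N ` L) \<in> N ` L"
    by simp
  then obtain \<alpha> where \<alpha>: "\<alpha> \<in> L" "N \<alpha> = Max (N ` L)"
    by auto
  have N_le: "N \<beta> \<le> N \<alpha>" if "\<beta> \<in> L" for \<beta>
    using that \<alpha> \<open>finite L\<close> by simp
  have "\<beta> = \<alpha>" if "\<beta> \<in> K" "\<gamma> \<in> K" and eq: "\<beta> + \<gamma> = \<alpha> + \<alpha>" for \<beta> \<gamma>
  proof -
    \<comment> \<open>Two degrees that are at most \<open>D\<close> and add up to
      \<open>2 * D\<close> both equal \<open>D\<close>, so the maximality of
      \<open>N \<alpha>\<close> on \<open>L\<close> applies to \<beta> and \<gamma>.\<close>
    have "monom_degree \<beta> + monom_degree \<gamma> = D + D"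
      using arg_cong [OF eq, of monom_degree] \<alpha>(1) by (simp add: monom_degree_add L_def)
    with D_ge [OF that(1)] D_ge [OF that(2)] have "\<beta> \<in> L" "\<gamma> \<in> L"
      using that by (auto simp: L_def)
    have sum_eq: "int (Poly_Mapping.lookup \<beta> j) + int (Poly_Mapping.lookup \<gamma> j) =
        2 * int (Poly_Mapping.lookup \<alpha> j)" for j
      using arg_cong [OF eq, of "\<lambda>\<delta>. int (Poly_Mapping.lookup \<delta> j)"] by (simp add: lookup_add)
    \<comment> \<open>the parallelogram law\<close>
    have "2 * (int (Poly_Mapping.lookup \<beta> j) - int (Poly_Mapping.lookup \<alpha> j))\<^sup>2 =
        (int (Poly_Mapping.lookup \<beta> j))\<^sup>2 + (int (Poly_Mapping.lookup \<gamma> j))\<^sup>2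
        - 2 * (int (Poly_Mapping.lookup \<alpha> j))\<^sup>2" for j
      using sum_eq [of j] by algebra
    then have "2 * (\<Sum>j\<in>UNIV. (int (Poly_Mapping.lookup \<beta> j) - int (Poly_Mapping.lookup \<alpha> j))\<^sup>2) =
        N \<beta> + N \<gamma> - 2 * N \<alpha>"
      by (simp add: N_def sum_distrib_left sum.distrib sum_subtractf)
    also have "\<dots> \<le> 0"
      using N_le [OF \<open>\<beta> \<in> L\<close>] N_le [OF \<open>\<gamma> \<in> L\<close>] by simp
    finally have "(\<Sum>j\<in>UNIV. (int (Poly_Mapping.lookup \<beta> j) - int (Poly_Mapping.lookup \<alpha> j))\<^sup>2) = 0"
      by (intro antisym sum_nonneg) auto
    then show ?thesis
      by (intro poly_mapping_eqI) (simp add: sum_nonneg_eq_0_iff)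
  qed
  with \<alpha>(1) D_ge show thesis
    by (intro that [of \<alpha>]) (auto simp: L_def)
qed

lemma monom_degree_le_of_sum_squares:
  fixes g :: "'i \<Rightarrow> 'n::finite real_mpoly"
  assumes "finite I" and deg: "total_degree (\<Sum>i\<in>I. (g i)\<^sup>2) \<le> 2 * d"
    and "i \<in> I" "\<beta> \<in> Poly_Mapping.keys (g i)"
  shows "monom_degree \<beta> \<le> d"
proof -
  \<comment> \<open>Pooling the monomials of all \<open>g i\<close> makes a single \<alpha> extreme
    for every one of them.\<close>
  define K where "K = (\<Union>i\<in>I. Poly_Mapping.keys (g i))"
  have "finite K" "\<beta> \<in> K"
    using assms by (auto simp: K_def)
  then obtain \<alpha> where \<alpha>: "\<alpha> \<in> K" "\<And>\<beta>. \<beta> \<in> K \<Longrightarrow> monom_degree \<beta> \<le> monom_degree \<alpha>"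
    and extreme: "\<And>\<beta> \<gamma>. \<beta> \<in> K \<Longrightarrow> \<gamma> \<in> K \<Longrightarrow> \<beta> + \<gamma> = \<alpha> + \<alpha> \<Longrightarrow> \<beta> = \<alpha>"
    using extreme_monomial_exists [of K] by blast
  have "Poly_Mapping.lookup (\<Sum>i\<in>I. (g i)\<^sup>2) (\<alpha> + \<alpha>) =
      (\<Sum>i\<in>I. (Poly_Mapping.lookup (g i) \<alpha>)\<^sup>2)"
    unfolding lookup_sum
    by (intro sum.cong refl lookup_power2_extreme extreme) (auto simp: K_def)
  \<comment> \<open>Some \<open>g i\<close> contains \<alpha>, so one square is positive, and no
    other square can cancel it.\<close>
  also have "\<dots> \<noteq> 0"
    using \<alpha>(1) \<open>finite I\<close> by (auto simp: K_def sum_nonneg_eq_0_iff in_keys_iff)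
  finally have "monom_degree (\<alpha> + \<alpha>) \<le> total_degree (\<Sum>i\<in>I. (g i)\<^sup>2)"
    by (intro monom_degree_le_total_degree) (simp add: in_keys_iff)
  with deg \<alpha>(2) [OF \<open>\<beta> \<in> K\<close>] show ?thesis
    by (simp add: monom_degree_add)
qed

section \<open>Gram matrices and comparison with the infimum\<close>

lemma quad_form_rank_one: "quad_form A (\<lambda>\<alpha> \<beta>. c \<alpha> * c \<beta>) v = (\<Sum>\<alpha>\<in>A. c \<alpha> * v \<alpha>)\<^sup>2"
  by (simp add: quad_form_def power2_eq_square sum_product mult_ac)

lemma sym_psd_on_rank_one: "sym_psd_on A (\<lambda>\<alpha> \<beta>. c \<alpha> * c \<beta>)"
  by (simp add: sym_psd_on_def quad_form_rank_one)

lemma sos_value_le_inf_value: "sos_value f \<le> inf_value f"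
  unfolding sos_value_def inf_value_def
  using is_sos_eval_nonneg
  by (intro SUP_least INF_greatest) (force simp: mpoly_eval_diff)

lemma sparse_sos_value_le_inf_value: "sparse_sos_value d m \<Delta> f \<le> inf_value f"
proof -
  have "\<gamma> \<le> mpoly_eval f x" if feasible: "sparse_sos_feasible d m \<Delta> f \<gamma>" for \<gamma> x
  proof -
    obtain W where W: "\<forall>i\<in>{1..m}. sym_psd_on (monomials d (\<Delta> i)) (W i)"
      "mpoly_eval f x - \<gamma> =
        (\<Sum>i=1..m. quad_form (monomials d (\<Delta> i)) (W i) (\<lambda>\<alpha>. monom_eval \<alpha> x))"
      using feasible unfolding sparse_sos_feasible_def by blast
    have "0 \<le> mpoly_eval f x - \<gamma>"
      unfolding W(2) using W(1) by (intro sum_nonneg) (simp add: sym_psd_on_def)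
    then show ?thesis
      by simp
  qed
  then show ?thesis
    unfolding sparse_sos_value_def inf_value_def
    by (intro SUP_least INF_greatest) simp
qed

text \<open>If \<open>c\<close> is the coefficient vector of \<open>g i\<close>, then
  \<open>c c^T\<close> is a Gram matrix of its square. The inclusion of keys ensures that the index
  set captures every term of \<open>g i\<close>.\<close>

lemma sum_squares_sparse_feasible:
  fixes g :: "nat \<Rightarrow> 'n::finite real_mpoly"
  assumes "\<And>i. i \<in> {1..m} \<Longrightarrow> Poly_Mapping.keys (g i) \<subseteq> monomials d (\<Delta> i)"
  shows "sparse_sos_feasible d m \<Delta> (\<Sum>i=1..m. (g i)\<^sup>2) 0"
proof -
  let ?c = "\<lambda>i. Poly_Mapping.lookup (g i)"
  have "mpoly_eval (g i) x = (\<Sum>\<alpha>\<in>monomials d (\<Delta> i). ?c i \<alpha> * monom_eval \<alpha> x)"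
    if "i \<in> {1..m}" for i x
    unfolding mpoly_eval_def using assms [OF that] finite_monomials
    by (intro sum.mono_neutral_left) (auto simp: in_keys_iff)
  then have "mpoly_eval (\<Sum>i=1..m. (g i)\<^sup>2) x - 0 =
      (\<Sum>i=1..m. quad_form (monomials d (\<Delta> i)) (\<lambda>\<alpha> \<beta>. ?c i \<alpha> * ?c i \<beta>) (\<lambda>\<alpha>. monom_eval \<alpha> x))"
    for x
    by (simp add: mpoly_eval_sum mpoly_eval_power2 quad_form_rank_one)
  then show ?thesis
    unfolding sparse_sos_feasible_def
    by (intro exI [of _ "\<lambda>i \<alpha> \<beta>. ?c i \<alpha> * ?c i \<beta>"]) (simp add: sym_psd_on_rank_one)
qed

theorem theorem3p12:
  fixes \<Delta> :: "nat \<Rightarrow> 'n::finite set"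
    and g :: "nat \<Rightarrow> 'n real_mpoly"
    and f :: "'n real_mpoly"
    and m d :: nat
  assumes g_vars: "\<And>i. i \<in> {1..m} \<Longrightarrow> g i \<in> mpolys_in (\<Delta> i)"
    and f_eq: "f = (\<Sum>i=1..m. (g i)\<^sup>2)"
    and deg_f: "total_degree f = 2 * d"
    and common_zero: "\<exists>x. \<forall>i\<in>{1..m}. mpoly_eval (g i) x = 0"
  shows "sparse_sos_value d m \<Delta> f = sos_value f \<and> sos_value f = inf_value f"
proof -
  obtain x where "\<forall>i\<in>{1..m}. mpoly_eval (g i) x = 0"
    using common_zero by blast
  then have "mpoly_eval f x = 0"
    by (simp add: f_eq mpoly_eval_sum mpoly_eval_power2)
  then have inf_le: "inf_value f \<le> 0"
    unfolding inf_value_def by (intro INF_lower2 [of x]) simp_all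
  \<comment> \<open>The variables come from \<open>g_vars\<close>, the degree bound from the absence
    of cancellation among leading squares.\<close>
  have "Poly_Mapping.keys (g i) \<subseteq> monomials d (\<Delta> i)" if "i \<in> {1..m}" for i
    using g_vars [OF that] monom_degree_le_of_sum_squares [of "{1..m}" g d i] that deg_f
    by (auto simp: monomials_def mpolys_in_def f_eq)
  then have "sparse_sos_feasible d m \<Delta> f 0"
    unfolding f_eq by (rule sum_squares_sparse_feasible)
  then have sparse_ge: "0 \<le> sparse_sos_value d m \<Delta> f"
    unfolding sparse_sos_value_def by (intro SUP_upper2 [of 0]) simp_all
  \<comment> \<open>\<open>is_sos\<close> asks for a list of polynomials; \<open>upt\<close> omits
    its upper end, hence \<open>Suc m\<close>.\<close>
  have "f = (\<Sum>q\<leftarrow>map g [1..<Suc m]. q\<^sup>2)"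
    unfolding f_eq by (simp add: sum_list_distinct_conv_sum_set atLeastLessThanSuc_atLeastAtMost
        o_def del: upt_Suc)
  then have "is_sos (f - const_mpoly 0)"
    unfolding is_sos_def const_mpoly_def single_zero diff_zero by (rule exI)
  then have sos_ge: "0 \<le> sos_value f"
    unfolding sos_value_def by (intro SUP_upper2 [of 0]) simp_all
  \<comment> \<open>Both relaxation values lie between 0 and \<open>inf_value f\<close>, which is at
    most 0.\<close>
  have "inf_value f = 0" "sos_value f = 0" "sparse_sos_value d m \<Delta> f = 0"
    using inf_le sparse_ge sos_ge sos_value_le_inf_value [of f]
      sparse_sos_value_le_inf_value [of d m \<Delta> f] by (auto intro!: antisym)
  then show ?thesis
    by simp
qed

end
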